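(* Let $r=m=3$. Let $a_{ij}\in\mathbb{C}$ ($1\le i,j\le 3$) and $f_i=\sum_{j=1}^3 a_{ij}z_j$. Let $S_1$ be the family $(z_1^2,z_2^2,z_3^2,f_1^2,f_2^2,f_3^2)$ in $\mathbb{C}[z_1,z_2,z_3]$ and $S_3$ the family of the $20$ products of three distinct members of $S_1$. Then $S_3$ is linearly independent if and only if $S_1$ is linearly independent.
   Context: For a finite family $S_1=(p_1,\dots,p_l)$ of polynomials and $1\le k\le l$, $S_k$ denotes the family $(p_{i_1}p_{i_2}\cdots p_{i_k})_{1\le i_1<\dots<i_k\le l}$ of the $\binom{l}{k}$ products of $k$ members of $S_1$ with distinct indices. A family is linearly independent (over $\mathbb{C}$) if no nontrivial $\mathbb{C}$-linear combination of its members (counted with their indices, so repeated members make the family dependent) vanishes. *)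

theory Defs
  imports Complex_Main "HOL-Library.Poly_Mapping"
begin

text \<open>Multivariate polynomials over C: monomials are finitely supported
  exponent vectors (variable index nat to exponent), polynomials are finitely
  supported coefficient maps. Variable z_j is Var (j-1), j = 1,2,3.\<close>

type_synonym cpoly = "(nat \<Rightarrow>\<^sub>0 nat) \<Rightarrow>\<^sub>0 complex"

definition Var :: "nat \<Rightarrow> cpoly" where
  "Var i = Poly_Mapping.single (Poly_Mapping.single i 1) 1"

definition Const :: "complex \<Rightarrow> cpoly" where
  "Const c = Poly_Mapping.single 0 c"

text \<open>Linear independence over C of a family (p i) indexed by a finite set I
  (repeated members make the family dependent).\<close>
definition lin_indep_fam :: "'i set \<Rightarrow> ('i \<Rightarrow> cpoly) \<Rightarrow> bool" where
  "lin_indep_fam I p \<longleftrightarrow>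
     (\<forall>c. (\<Sum>i\<in>I. Const (c i) * p i) = 0 \<longrightarrow> (\<forall>i\<in>I. c i = 0))"

definition prod_fam_index :: "nat \<Rightarrow> 'i set \<Rightarrow> 'i set set" where
  "prod_fam_index k I = {K. K \<subseteq> I \<and> card K = k}"

definition prod_fam :: "('i \<Rightarrow> cpoly) \<Rightarrow> 'i set \<Rightarrow> cpoly" where
  "prod_fam p K = (\<Prod>i\<in>K. p i)"

end

theory Submission
  imports Defs
begin

text \<open>
  Write \<open>l\<^sub>0, \<dots>, l\<^sub>5\<close> for the six linear forms, viewed as lines, and \<open>[i j k]\<close> for \<open>3\<times>3\<close> determinants.

  Suppose the squares are independent and \<open>\<Sum>T. c\<^sub>T \<Prod>i\<in>T. l\<^sub>i\<^sup>2 = 0\<close>. Expanding at the point where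
  \<open>l\<^sub>a\<close> and \<open>l\<^sub>b\<close> meet, modulo \<open>l\<^sub>a\<^sup>2\<close> and \<open>l\<^sub>b\<^sup>2\<close>, only the four triples avoiding \<open>a\<close> and \<open>b\<close> survive. If no
  other line passes through the point, dividing by the product of the four remaining squares gives
  a nonsingular system of four equations, so these four coefficients vanish. No four of the lines
  are concurrent; if exactly three are, the coefficient of the complementary triple vanishes by
  evaluation at the common point. A triple is left over only if its three lines pass through the three vertices of
  the triangle formed by the other three lines; then other coefficients are already known to
  vanish, and one further coefficient of the expansion finishes the argument.

  Conversely, \<open>\<Sum>T. \<plusminus>[T\<^sup>c]\<^sup>3 [T] \<Prod>i\<in>T. l\<^sub>i\<^sup>2 = -6 e \<Prod>i. l\<^sub>i\<close>, where \<open>e\<close> is the determinant of the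
  six squares. If the squares are dependent, this is a relation between the triple products. When
  it is trivial, two of the lines coincide, one form is zero, or four lines are concurrent, and in
  each case there is a shorter relation.
\<close>

section \<open>Constants, truncated jets, and substitution of jets into polynomials\<close>

lemma Const_simps: "Const 0 = 0" "Const 1 = 1"
  "Const (x + y) = Const x + Const y" "Const (x * y) = Const x * Const y"
  "Const (- x) = - Const x" "Const (x - y) = Const x - Const y"
  "Const (x ^ n) = Const x ^ n" "Const (numeral k) = numeral k"
proof -
  show m: "Const (x * y) = Const x * Const y" for x y by (simp add: Const_def mult_single)
  show o: "Const 1 = 1" by (simp add: Const_def)
  show "Const (x ^ n) = Const x ^ n" by (induction n) (simp_all add: m o)
qed (simp_all add: Const_def single_add single_uminus single_diff)

lemma Const_sum: "Const (sum g A) = (\<Sum>i\<in>A. Const (g i))"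
  by (induction A rule: infinite_finite_induct) (simp_all add: Const_simps)

text \<open>The ring \<open>\<complex>[X, Y] / (X\<^sup>2, Y\<^sup>2)\<close>: \<open>Jet p q r s\<close> stands for \<open>p + q X + r Y + s X Y\<close>.\<close>

datatype jet = Jet (j00: complex) (j10: complex) (j01: complex) (j11: complex)

instantiation jet :: comm_ring_1
begin

definition "0 = Jet 0 0 0 0"
definition "1 = Jet 1 0 0 0"
definition "p + q = Jet (j00 p + j00 q) (j10 p + j10 q) (j01 p + j01 q) (j11 p + j11 q)"
definition "- p = Jet (- j00 p) (- j10 p) (- j01 p) (- j11 p)"
definition "p - q = Jet (j00 p - j00 q) (j10 p - j10 q) (j01 p - j01 q) (j11 p - j11 q)"
definition "p * q = Jet (j00 p * j00 q) (j00 p * j10 q + j10 p * j00 q)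
  (j00 p * j01 q + j01 p * j00 q)
  (j00 p * j11 q + j10 p * j01 q + j01 p * j10 q + j11 p * j00 q)"

instance
  by standard
    (simp_all add: zero_jet_def one_jet_def plus_jet_def uminus_jet_def minus_jet_def
      times_jet_def algebra_simps)

end

lemmas jet_defs = zero_jet_def one_jet_def plus_jet_def uminus_jet_def minus_jet_def times_jet_def

lemma jet_sel_add:
  "j00 (p + q) = j00 p + j00 q" "j10 (p + q) = j10 p + j10 q"
  "j01 (p + q) = j01 p + j01 q" "j11 (p + q) = j11 p + j11 q"
  by (simp_all add: plus_jet_def)

lemma jet_sel_sum:
  "j00 (sum g A) = (\<Sum>i\<in>A. j00 (g i))" "j10 (sum g A) = (\<Sum>i\<in>A. j10 (g i))"
  "j01 (sum g A) = (\<Sum>i\<in>A. j01 (g i))" "j11 (sum g A) = (\<Sum>i\<in>A. j11 (g i))"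
  by (induction A rule: infinite_finite_induct) (simp_all add: zero_jet_def jet_sel_add)

lemma j00_prod: "j00 (prod g A) = (\<Prod>i\<in>A. j00 (g i))"
  by (induction A rule: infinite_finite_induct) (simp_all add: one_jet_def times_jet_def)

lemma j00_power2: "j00 (p\<^sup>2) = (j00 p)\<^sup>2"
  by (simp add: power2_eq_square times_jet_def)

definition jc :: "complex \<Rightarrow> jet" where
  "jc c = Jet c 0 0 0"

lemma jc_simps: "jc 0 = 0" "jc 1 = 1" "jc (x + y) = jc x + jc y" "jc (x * y) = jc x * jc y"
  by (simp_all add: jc_def jet_defs)

lemma jc_prod: "jc (prod g A) = (\<Prod>i\<in>A. jc (g i))"
  by (induction A rule: infinite_finite_induct) (simp_all add: jc_simps)

text \<open>Only the variables with index below 3 are substituted; all others are sent to 1.\<close>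

definition psubst :: "(nat \<Rightarrow> jet) \<Rightarrow> cpoly \<Rightarrow> jet" where
  "psubst u p = (\<Sum>m\<in>Poly_Mapping.keys p. jc (Poly_Mapping.lookup p m) * (\<Prod>i<3. u i ^ Poly_Mapping.lookup m i))"

lemma psubst_superset:
  assumes "finite K" "Poly_Mapping.keys p \<subseteq> K"
  shows "psubst u p = (\<Sum>m\<in>K. jc (Poly_Mapping.lookup p m) * (\<Prod>i<3. u i ^ Poly_Mapping.lookup m i))"
  unfolding psubst_def
  by (rule sum.mono_neutral_left) (use assms in \<open>auto simp: in_keys_iff jc_simps\<close>)

lemma psubst_add: "psubst u (p + q) = psubst u p + psubst u q"
proof -
  let ?K = "Poly_Mapping.keys p \<union> Poly_Mapping.keys q"
  have "Poly_Mapping.keys (p + q) \<subseteq> ?K" by (rule Poly_Mapping.keys_add)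
  then show ?thesis
    by (simp add: psubst_superset[of ?K] lookup_add jc_simps distrib_right sum.distrib)
qed

lemma psubst_single:
  "psubst u (Poly_Mapping.single m c) = jc c * (\<Prod>i<3. u i ^ Poly_Mapping.lookup m i)"
  by (simp add: psubst_superset[of "{m}"])

lemma psubst_zero [simp]: "psubst u 0 = 0"
  by (simp add: psubst_def)

lemma psubst_sum: "psubst u (sum g A) = (\<Sum>i\<in>A. psubst u (g i))"
  by (induction A rule: infinite_finite_induct) (simp_all add: psubst_add)

lemma psubst_mult: "psubst u (p * q) = psubst u p * psubst u q"
proof -
  have decomp: "p = (\<Sum>m\<in>Poly_Mapping.keys p. Poly_Mapping.single m (Poly_Mapping.lookup p m))"
    for p :: cpoly by (rule poly_mapping_eqI) (auto simp: lookup_sum lookup_single when_def in_keys_iff sum.delta)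
  have "psubst u (Poly_Mapping.single m c * Poly_Mapping.single n d) =
      psubst u (Poly_Mapping.single m c) * psubst u (Poly_Mapping.single n d)" for m c n d
    by (simp add: mult_single psubst_single lookup_add power_add prod.distrib jc_simps ac_simps)
  then show ?thesis
    by (subst (1 2 3 4) decomp) (simp add: sum_product psubst_sum)
qed

lemma psubst_Const [simp]: "psubst u (Const c) = jc c"
  by (simp add: Const_def psubst_single)

lemma psubst_one [simp]: "psubst u 1 = 1"
  using psubst_Const[of u 1] by (simp add: Const_simps jc_simps)

lemma psubst_power: "psubst u (p ^ n) = psubst u p ^ n"
  by (induction n) (simp_all add: psubst_mult)

lemma psubst_prod: "psubst u (prod g A) = (\<Prod>i\<in>A. psubst u (g i))"
  by (induction A rule: infinite_finite_induct) (simp_all add: psubst_mult)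

lemma psubst_Var: "i < 3 \<Longrightarrow> psubst u (Var i) = u i"
proof -
  assume "i < 3"
  have "psubst u (Var i) = (\<Prod>j<3. u j ^ (1 when i = j))"
    by (simp add: Var_def psubst_single lookup_single jc_simps)
  also have "\<dots> = (\<Prod>j<3. if j = i then u i else 1)"
    by (rule prod.cong) (auto simp: when_def)
  also have "\<dots> = u i" using \<open>i < 3\<close> by simp
  finally show ?thesis .
qed

section \<open>Linear forms, determinants and points of intersection\<close>

definition form :: "(nat \<Rightarrow> complex) \<Rightarrow> cpoly" where
  "form v = (\<Sum>j<3. Const (v j) * Var j)"

definition det3 :: "(nat \<Rightarrow> complex) \<Rightarrow> (nat \<Rightarrow> complex) \<Rightarrow> (nat \<Rightarrow> complex) \<Rightarrow> complex" where
  "det3 u v w = u 0 * (v 1 * w 2 - v 2 * w 1) - u 1 * (v 0 * w 2 - v 2 * w 0)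
     + u 2 * (v 0 * w 1 - v 1 * w 0)"

lemma lessThan_3: "{..<3} = {0, 1, 2 :: nat}"
  by auto

text \<open>Cramer's rule for expanding \<open>v\<close> in \<open>m\<close>, \<open>a\<close>,
  \<open>b\<close>, cleared of denominators so that no determinant has to be nonzero.\<close>

lemma cramer_form:
  "Const (det3 m a b) * form v =
     Const (det3 v a b) * form m + Const (det3 v b m) * form a + Const (det3 v m a) * form b"
  unfolding form_def lessThan_3 det3_def by (simp add: Const_simps) algebra

lemma parallel_forms:
  assumes "\<And>m. det3 m u v = 0"
  obtains s t where "s \<noteq> 0 \<or> t \<noteq> 0" "Const s * form u = Const t * form v"
proof (cases "\<forall>j<3. u j = 0")
  case True
  then have "form u = 0" by (simp add: form_def Const_simps)
  then show thesis using that[of 1 0] by (simp add: Const_simps)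
next
  case False
  then obtain k where k: "k < 3" "u k \<noteq> 0" by auto
  \<comment> \<open>Taking the three unit vectors for \<open>m\<close> turns the hypothesis into the
    vanishing of all 2 by 2 minors of \<open>u\<close> and \<open>v\<close>.\<close>
  have "u 1 * v 2 = u 2 * v 1" "u 0 * v 2 = u 2 * v 0" "u 0 * v 1 = u 1 * v 0"
    using assms[of "\<lambda>j. if j = 0 then 1 else 0"] assms[of "\<lambda>j. if j = 1 then 1 else 0"]
      assms[of "\<lambda>j. if j = 2 then 1 else 0"] by (simp_all add: det3_def)
  then have *: "v k * u j = u k * v j" if "j < 3" for j
    using that k(1) by (auto simp: less_Suc_eq numeral_3_eq_3 numeral_2_eq_2 ac_simps)
  have "Const (v k) * form u = Const (u k) * form v"
    unfolding form_def sum_distrib_left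
    by (rule sum.cong) (simp_all add: mult.assoc[symmetric] Const_simps[symmetric] *)
  then show thesis using that k by blast
qed

lemma det3_perms: 
  "det3 v u w = - det3 u v w" "det3 u w v = - det3 u v w" "det3 w v u = - det3 u v w"
  by (simp_all add: det3_def algebra_simps)

lemma det3_cyclic: "det3 v w u = det3 u v w" "det3 w u v = det3 u v w"
  by (simp_all add: det3_def algebra_simps)

lemma det3_repeat [simp]: "det3 u u v = 0" "det3 u v u = 0" "det3 v u u = 0"
  by (simp_all add: det3_def algebra_simps)

lemma psubst_form:
  "psubst (\<lambda>i. Jet (x i) (y i) (z i) 0) (form v) =
     Jet (\<Sum>i<3. v i * x i) (\<Sum>i<3. v i * y i) (\<Sum>i<3. v i * z i) 0"
  by (simp add: form_def psubst_add psubst_mult psubst_Var lessThan_3)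
    (simp add: jc_def jet_defs)

text \<open>The cross product: for independent \<open>u\<close> and \<open>v\<close>, the
  homogeneous coordinates of the point where the two lines meet.\<close>

definition cross :: "(nat \<Rightarrow> complex) \<Rightarrow> (nat \<Rightarrow> complex) \<Rightarrow> nat \<Rightarrow> complex" where
  "cross u v i = (if i = 0 then u 1 * v 2 - u 2 * v 1 else if i = 1 then u 2 * v 0 - u 0 * v 2
     else u 0 * v 1 - u 1 * v 0)"

lemma sum_cross: "(\<Sum>i<3. w i * cross u v i) = det3 w u v"
  by (simp add: lessThan_3 cross_def det3_def algebra_simps)

lemma subset_card_diff_single:
  assumes "finite R" "T \<subseteq> R" "card R = Suc (card T)"
  obtains j where "j \<in> R" "T = R - {j}"
proof -
  have "card (R - T) = 1" using assms by (simp add: card_Diff_subset finite_subset)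
  then obtain j where "R - T = {j}" by (auto simp: card_1_singleton_iff)
  then show thesis using that[of j] assms(2) by blast
qed

section \<open>Local geometry of six lines with independent squares\<close>

locale six_forms =
  fixes L :: "nat \<Rightarrow> nat \<Rightarrow> complex"
  assumes indep: "lin_indep_fam {..<6} (\<lambda>i. (form (L i))\<^sup>2)"
begin

abbreviation dt :: "nat \<Rightarrow> nat \<Rightarrow> nat \<Rightarrow> complex" where
  "dt i j k \<equiv> det3 (L i) (L j) (L k)"

lemma indepD:
  assumes "(\<Sum>i<6. Const (c i) * (form (L i))\<^sup>2) = 0" "i < 6"
  shows "c i = 0"
  using indep assms unfolding lin_indep_fam_def by auto

text \<open>If no such \<open>m\<close> existed, the two forms would be proportional, and squaring
  the proportionality would give a relation between two of the squares.\<close>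

lemma not_parallel:
  assumes "a < 6" "b < 6" "a \<noteq> b"
  obtains m where "det3 (L a) (L b) m \<noteq> 0"
proof (rule ccontr)
  assume *: "\<not> thesis"
  have "det3 m (L a) (L b) = 0" for m
    using * that[of m] by (auto simp: det3_cyclic)
  then obtain s t where st: "s \<noteq> 0 \<or> t \<noteq> 0"
    "Const s * form (L a) = Const t * form (L b)" by (rule parallel_forms)
  define c where "c i = (if i = a then s\<^sup>2 else if i = b then - t\<^sup>2 else 0)" for i
  have "(\<Sum>i<6. Const (c i) * (form (L i))\<^sup>2) = (\<Sum>i\<in>{a,b}. Const (c i) * (form (L i))\<^sup>2)"
    by (rule sum.mono_neutral_right) (use assms in \<open>auto simp: c_def Const_simps\<close>)
  also have "\<dots> = (Const s * form (L a))\<^sup>2 - (Const t * form (L b))\<^sup>2"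
    using assms(3) by (simp add: c_def Const_simps power_mult_distrib)
  also have "\<dots> = 0" by (simp add: st)
  finally have "c a = 0" "c b = 0" using assms by (auto intro: indepD)
  then show False using st assms(3) by (auto simp: c_def)
qed

text \<open>
  With \<open>l\<^sub>j = la\<^sub>j W + al\<^sub>j X + be\<^sub>j Y\<close> and \<open>X = l\<^sub>a\<close>, \<open>Y = l\<^sub>b\<close> up to a factor, the four sums are the
  coefficients of \<open>W\<^sup>2\<close>, \<open>W X\<close>, \<open>W Y\<close>, \<open>X Y\<close> in \<open>\<Sum>j. d\<^sub>j l\<^sub>j\<^sup>2\<close>. If they vanish, this sum is a
  combination of \<open>l\<^sub>a\<^sup>2\<close> and \<open>l\<^sub>b\<^sup>2\<close>.
\<close>

lemma local_independence:
  assumes ab: "a < 6" "b < 6" "a \<noteq> b" and m: "det3 (L a) (L b) m \<noteq> 0"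
  defines "R \<equiv> {..<6} - {a, b}"
  defines "al \<equiv> \<lambda>j. det3 (L j) (L b) m" and "be \<equiv> \<lambda>j. det3 (L j) m (L a)"
    and "la \<equiv> \<lambda>j. dt j a b"
  assumes s: "(\<Sum>j\<in>R. d j * la j ^ 2) = 0" "(\<Sum>j\<in>R. d j * (la j * al j)) = 0"
    "(\<Sum>j\<in>R. d j * (la j * be j)) = 0" "(\<Sum>j\<in>R. d j * (al j * be j)) = 0"
    and j: "j \<in> R"
  shows "d j = 0"
proof -
  let ?D = "det3 m (L a) (L b)"
  have D: "?D \<noteq> 0" using m by (simp add: det3_cyclic)
  \<comment> \<open>The factor \<open>?D\<^sup>2\<close> pays for the denominators in Cramer's rule;
    the values at \<open>a\<close> and \<open>b\<close> cancel the remaining multiples of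
    \<open>l\<^sub>a\<^sup>2\<close> and \<open>l\<^sub>b\<^sup>2\<close>.\<close>
  define c where "c i = (if i = a then - (\<Sum>j\<in>R. d j * al j ^ 2)
    else if i = b then - (\<Sum>j\<in>R. d j * be j ^ 2) else ?D\<^sup>2 * d i)" for i
  let ?F = "\<lambda>i. form (L i)" and ?M = "form m"
  have R: "finite R" "a \<notin> R" "b \<notin> R" "{..<6} = insert a (insert b R)"
    using ab by (auto simp: R_def)
  have F: "Const ?D * ?F i = Const (la i) * ?M + Const (al i) * ?F a + Const (be i) * ?F b" for i
    using cramer_form[of m "L a" "L b" "L i"] by (simp add: la_def al_def be_def)
  have t: "Const (c i) * (?F i)\<^sup>2 = Const (d i * la i ^ 2) * ?M\<^sup>2
      + Const (d i * (la i * al i)) * (2 * ?M * ?F a) + Const (d i * (la i * be i)) * (2 * ?M * ?F b)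
      + Const (d i * (al i * be i)) * (2 * ?F a * ?F b)
      + Const (d i * al i ^ 2) * (?F a)\<^sup>2 + Const (d i * be i ^ 2) * (?F b)\<^sup>2" if "i \<in> R" for i
  proof -
    have "c i = ?D\<^sup>2 * d i" using that R(2,3) by (auto simp: c_def)
    then have *: "Const (c i) * (?F i)\<^sup>2 = Const (d i) * (Const ?D * ?F i)\<^sup>2"
      by (simp add: Const_simps power2_eq_square)
    show ?thesis unfolding * F Const_simps by (simp add: power2_eq_square algebra_simps)
  qed
  have "(\<Sum>i\<in>R. Const (c i) * (?F i)\<^sup>2) =
      Const (\<Sum>i\<in>R. d i * al i ^ 2) * (?F a)\<^sup>2 + Const (\<Sum>i\<in>R. d i * be i ^ 2) * (?F b)\<^sup>2"
    by (simp add: t sum.distrib sum_distrib_right[symmetric] Const_sum[symmetric] s Const_simps(1))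
  moreover have "(\<Sum>i<6. Const (c i) * (?F i)\<^sup>2) = Const (c a) * (?F a)\<^sup>2
      + (Const (c b) * (?F b)\<^sup>2 + (\<Sum>i\<in>R. Const (c i) * (?F i)\<^sup>2))"
    using R(1-3) ab(3) by (simp add: R(4))
  ultimately have "(\<Sum>i<6. Const (c i) * (?F i)\<^sup>2) = 0"
    using ab(3) by (simp add: c_def[of a] c_def[of b] Const_simps(5))
  then have "c j = 0" using j by (intro indepD) (auto simp: R_def)
  moreover have "j \<noteq> a" "j \<noteq> b" using j by (auto simp: R_def)
  ultimately show ?thesis using D by (simp add: c_def)
qed

text \<open>If \<open>l\<^sub>j\<close> and \<open>l\<^sub>k\<close> both passed through the common
  point, their \<open>la\<close> would vanish. Only the \<open>X Y\<close> equation would then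
  constrain the two unknowns \<open>d\<^sub>j\<close>, \<open>d\<^sub>k\<close>, leaving a nonzero
  solution.\<close>

lemma at_most_one_concurrent:
  assumes "a < 6" "b < 6" "j < 6" "k < 6" "distinct [a, b, j, k]" "dt a b j = 0"
  shows "dt a b k \<noteq> 0"
proof
  assume k: "dt a b k = 0"
  obtain m where m: "det3 (L a) (L b) m \<noteq> 0" using not_parallel assms by auto
  let ?al = "\<lambda>j. det3 (L j) (L b) m" and ?be = "\<lambda>j. det3 (L j) m (L a)"
  have la: "dt j a b = 0" "dt k a b = 0" using assms(6) k by (simp_all add: det3_cyclic)
  have R: "finite ({..<6} - {a, b})" "j \<in> {..<6} - {a, b}" "k \<in> {..<6} - {a, b}"
    using assms by auto
  define p where "p i = ?al i * ?be i" for i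
  \<comment> \<open>This solves \<open>d\<^sub>j p\<^sub>j + d\<^sub>k p\<^sub>k = 0\<close>. It is
    trivial only if both \<open>p\<close> vanish; once \<open>p k = 0\<close> is known, the
    indicator \<open>e\<close> of \<open>k\<close> is a nonzero solution.\<close>
  define d where "d i = (if i = j then p k else if i = k then - p j else 0)" for i
  have sum_d: "(\<Sum>i\<in>{..<6} - {a, b}. d i * g i) = p k * g j - p j * g k" for g
  proof -
    have "(\<Sum>i\<in>{..<6} - {a, b}. d i * g i) = (\<Sum>i\<in>{j, k}. d i * g i)"
      by (rule sum.mono_neutral_right) (use R in \<open>auto simp: d_def\<close>)
    then show ?thesis using assms(5) by (simp add: d_def)
  qed
  have "d i = 0" if "i \<in> {..<6} - {a, b}" for i
    by (rule local_independence[OF assms(1,2) _ m _ _ _ _ that])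
      (use assms(5) in \<open>simp_all add: sum_d la p_def\<close>)
  from this[OF R(2)] have pk: "p k = 0" by (simp add: d_def)
  define e where "e i = (if i = k then 1 else 0 :: complex)" for i
  have sum_e: "(\<Sum>i\<in>{..<6} - {a, b}. e i * g i) = g k" for g
  proof -
    have "(\<Sum>i\<in>{..<6} - {a, b}. e i * g i) = (\<Sum>i\<in>{k}. e i * g i)"
      by (rule sum.mono_neutral_right) (use R in \<open>auto simp: e_def\<close>)
    then show ?thesis by (simp add: e_def)
  qed
  have "e k = 0"
    by (rule local_independence[OF assms(1,2) _ m _ _ _ _ R(3)])
      (use assms(5) pk in \<open>simp_all add: sum_e la p_def\<close>)
  then show False by (simp add: e_def)
qed

text \<open>Otherwise \<open>l\<^sub>k\<^sup>2\<close> by itself would be a combination of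
  \<open>l\<^sub>a\<^sup>2\<close> and \<open>l\<^sub>b\<^sup>2\<close>. The product is half the
  \<open>X Y\<close> coefficient of the square of the jet of \<open>l\<^sub>k\<close>.\<close>

lemma concurrent_coordinates_nonzero:
  assumes "a < 6" "b < 6" "a \<noteq> b" "k \<in> {..<6} - {a, b}" "dt k a b = 0"
    and m: "det3 (L a) (L b) m \<noteq> 0"
  shows "det3 (L k) (L b) m * det3 (L k) m (L a) \<noteq> 0"
proof
  assume p: "det3 (L k) (L b) m * det3 (L k) m (L a) = 0"
  define e where "e i = (if i = k then 1 else 0 :: complex)" for i
  have sum_e: "(\<Sum>i\<in>{..<6} - {a, b}. e i * g i) = g k" for g
  proof -
    have "(\<Sum>i\<in>{..<6} - {a, b}. e i * g i) = (\<Sum>i\<in>{k}. e i * g i)"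
      by (rule sum.mono_neutral_right) (use assms(4) in \<open>auto simp: e_def\<close>)
    then show ?thesis by (simp add: e_def)
  qed
  have "e k = 0"
    by (rule local_independence[OF assms(1-3) m _ _ _ _ assms(4)])
      (use assms(5) p in \<open>simp_all add: sum_e\<close>)
  then show False by (simp add: e_def)
qed

end

section \<open>Local expansions of a relation between triple products\<close>

locale six_forms_relation = six_forms +
  fixes c :: "nat set \<Rightarrow> complex"
  assumes rel: "(\<Sum>T\<in>prod_fam_index 3 {..<6}. Const (c T) * prod_fam (\<lambda>i. (form (L i))\<^sup>2) T) = 0"
begin

text \<open>The substituted point is \<open>cross (L a) (L b)\<close>, moved along \<open>X\<close>
  and \<open>Y\<close> so that \<open>l\<^sub>a\<close> and \<open>l\<^sub>b\<close> become
  multiples of \<open>X\<close> and \<open>Y\<close>. Their squares vanish, which leaves the triples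
  inside the four-element set \<open>R\<close>.\<close>

lemma jet_relation:
  fixes m :: "nat \<Rightarrow> complex"
  assumes "a < 6" "b < 6" "a \<noteq> b"
  defines "R \<equiv> {..<6} - {a, b}"
  defines "h \<equiv> \<lambda>j. Jet (dt j a b) (det3 (L j) (L b) m) (det3 (L j) m (L a)) 0"
  shows "(\<Sum>j\<in>R. jc (c (R - {j})) * (\<Prod>k\<in>R - {j}. (h k)\<^sup>2)) = 0"
proof -
  let ?u = "\<lambda>i. Jet (cross (L a) (L b) i) (cross (L b) m i) (cross m (L a) i) 0"
  let ?P = "prod_fam_index 3 {..<6} :: nat set set"
  let ?g = "\<lambda>T. jc (c T) * (\<Prod>k\<in>T. (h k)\<^sup>2)"
  have h: "psubst ?u (form (L j)) = h j" for j
    by (simp only: psubst_form sum_cross h_def)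
  have h0: "(h a)\<^sup>2 = 0" "(h b)\<^sup>2 = 0"
    by (simp_all add: h_def jet_defs power2_eq_square)
  have "psubst ?u (\<Sum>T\<in>?P. Const (c T) * prod_fam (\<lambda>i. (form (L i))\<^sup>2) T) = (\<Sum>T\<in>?P. ?g T)"
    by (simp add: psubst_sum psubst_mult prod_fam_def psubst_prod psubst_power h)
  then have "(\<Sum>T\<in>?P. ?g T) = 0" by (simp add: rel)
  have R: "finite R" "card R = Suc 3"
    using assms(1-3) by (simp_all add: R_def card_Diff_subset)
  have "(\<Sum>T\<in>?P. ?g T) = (\<Sum>T\<in>(\<lambda>j. R - {j}) ` R. ?g T)"
  proof (rule sum.mono_neutral_right)
    show "finite ?P"
      by (rule finite_subset[of _ "Pow {..<6}"]) (auto simp: prod_fam_index_def)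
    show "(\<lambda>j. R - {j}) ` R \<subseteq> ?P"
      using R by (auto simp: prod_fam_index_def R_def)
    show "\<forall>T\<in>?P - (\<lambda>j. R - {j}) ` R. ?g T = 0"
    proof
      fix T assume T: "T \<in> ?P - (\<lambda>j. R - {j}) ` R"
      then have T': "T \<subseteq> {..<6}" "card T = 3" "finite T"
        by (auto simp: prod_fam_index_def finite_subset)
      have "\<not> T \<subseteq> R"
      proof
        assume "T \<subseteq> R"
        then obtain j where "j \<in> R" "T = R - {j}"
          using subset_card_diff_single[of R T] R T' by auto
        then show False using T by auto
      qed
      then have "a \<in> T \<or> b \<in> T" using T' by (auto simp: R_def)
      then have "(\<Prod>k\<in>T. (h k)\<^sup>2) = 0" using h0 T'(3) by (intro prod_zero) auto
      then show "?g T = 0" by simp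
    qed
  qed
  also have "\<dots> = (\<Sum>j\<in>R. ?g (R - {j}))"
    by (rule sum.reindex_cong[where l = "\<lambda>j. R - {j}"]) (auto simp: inj_on_def)
  finally show ?thesis using \<open>(\<Sum>T\<in>?P. ?g T) = 0\<close> by simp
qed

text \<open>All four remaining forms are units in the jet ring. Dividing by the product of their
  squares gives a sum of multiples of \<open>1 / (h j)\<^sup>2\<close>, whose four coefficients are,
  up to nonzero factors, the sums in \<open>local_independence\<close>.\<close>

lemma coeff_zero_clean:
  assumes "a < 6" "b < 6" "a \<noteq> b" "x \<in> {..<6} - {a, b}"
    and nz: "\<And>j. j \<in> {..<6} - {a, b} \<Longrightarrow> dt a b j \<noteq> 0"
  shows "c ({..<6} - {a, b} - {x}) = 0"
proof -
  obtain m where m: "det3 (L a) (L b) m \<noteq> 0" using not_parallel assms by auto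
  define R where "R = {..<6} - {a, b}"
  define la where "la j = dt j a b" for j
  define al where "al j = det3 (L j) (L b) m" for j
  define be where "be j = det3 (L j) m (L a)" for j
  define h where "h j = Jet (la j) (al j) (be j) 0" for j
  \<comment> \<open>\<open>k j\<close> is \<open>la\<^sub>j\<^sup>4 / h\<^sub>j\<^sup>2\<close>, so multiplying the relation by \<open>\<Prod>j\<in>R. k j\<close> leaves one factor per term.\<close>
  define k where "k j = Jet (la j ^ 2) (- 2 * la j * al j) (- 2 * la j * be j) (6 * al j * be j)" for j
  define d where "d j = c (R - {j}) * (\<Prod>i\<in>R - {j}. la i ^ 4)" for j
  have la: "la j \<noteq> 0" if "j \<in> R" for j
    using nz[of j] that by (simp add: R_def la_def det3_cyclic)
  have R: "finite R" by (simp add: R_def)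
  have hk: "(h j)\<^sup>2 * k j = jc (la j ^ 4)" for j
    by (simp add: h_def k_def jet_defs jc_def power2_eq_square power4_eq_xxxx algebra_simps)
  have "0 = (\<Sum>j\<in>R. jc (c (R - {j})) * (\<Prod>i\<in>R - {j}. (h i)\<^sup>2)) * (\<Prod>i\<in>R. k i)"
    using jet_relation[OF assms(1-3), of m]
    by (simp add: R_def h_def[abs_def] la_def al_def be_def)
  also have "\<dots> = (\<Sum>j\<in>R. jc (d j) * k j)"
    unfolding sum_distrib_right
  proof (rule sum.cong)
    fix j assume "j \<in> R"
    then have "(\<Prod>i\<in>R. k i) = k j * (\<Prod>i\<in>R - {j}. k i)" using R by (simp add: prod.remove)
    moreover have "(\<Prod>i\<in>R - {j}. (h i)\<^sup>2) * (\<Prod>i\<in>R - {j}. k i) = jc (\<Prod>i\<in>R - {j}. la i ^ 4)"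
      by (simp add: prod.distrib[symmetric] hk jc_prod)
    ultimately show "jc (c (R - {j})) * (\<Prod>i\<in>R - {j}. (h i)\<^sup>2) * prod k R = jc (d j) * k j"
      by (simp add: d_def jc_simps(4) ac_simps)
  qed simp
  finally have *: "(\<Sum>j\<in>R. jc (d j) * k j) = 0" by simp
  have jets: "(\<Sum>j\<in>R. d j * la j ^ 2) = 0" "(\<Sum>j\<in>R. d j * (- 2 * la j * al j)) = 0"
    "(\<Sum>j\<in>R. d j * (- 2 * la j * be j)) = 0" "(\<Sum>j\<in>R. d j * (6 * al j * be j)) = 0"
    using arg_cong[OF *, of j00] arg_cong[OF *, of j10] arg_cong[OF *, of j01] arg_cong[OF *, of j11]
    by (simp_all add: jet_sel_sum) (simp_all add: jc_def k_def times_jet_def zero_jet_def)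
  have pull: "(\<Sum>j\<in>R. d j * (r * la j * al j)) = r * (\<Sum>j\<in>R. d j * (la j * al j))"
    "(\<Sum>j\<in>R. d j * (r * la j * be j)) = r * (\<Sum>j\<in>R. d j * (la j * be j))"
    "(\<Sum>j\<in>R. d j * (r * al j * be j)) = r * (\<Sum>j\<in>R. d j * (al j * be j))" for r
    by (simp_all add: sum_distrib_left ac_simps)
  have "d x = 0"
    by (rule local_independence[OF assms(1-3) m _ _ _ _ assms(4)])
      (use jets[unfolded pull] in \<open>simp_all add: R_def la_def al_def be_def\<close>)
  then show ?thesis using la R unfolding d_def R_def[symmetric] by (auto simp: prod_zero_iff)
qed

text \<open>At the common point \<open>l\<^sub>x\<close> vanishes, so the only term that survives is
  the one without \<open>x\<close>; its three factors are nonzero because no four lines are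
  concurrent.\<close>

lemma coeff_zero_concurrent:
  assumes "a < 6" "b < 6" "a \<noteq> b" "x \<in> {..<6} - {a, b}" "dt a b x = 0"
  shows "c ({..<6} - {a, b} - {x}) = 0"
proof -
  define R where "R = {..<6} - {a, b}"
  define g where "g j = c (R - {j}) * (\<Prod>k\<in>R - {j}. dt k a b ^ 2)" for j
  have R: "finite R" "x \<in> R" using assms by (simp_all add: R_def)
  have x: "dt x a b = 0" using assms by (simp add: det3_cyclic)
  have "(\<Sum>j\<in>R. g j) = 0"
    \<comment> \<open>The constant coefficient does not involve \<open>m\<close>, so any vector will
      do.\<close>
    using arg_cong[OF jet_relation[OF assms(1-3), of undefined], of j00]
    by (simp add: R_def[symmetric] g_def jet_sel_sum times_jet_def j00_prod jc_def
        power2_eq_square zero_jet_def)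
  moreover have "(\<Sum>j\<in>R. g j) = (\<Sum>j\<in>{x}. g j)"
    by (rule sum.mono_neutral_right) (use R x in \<open>auto simp: g_def intro!: prod_zero\<close>)
  ultimately have "g x = 0" by simp
  moreover have "dt k a b \<noteq> 0" if "k \<in> R - {x}" for k
    using at_most_one_concurrent[of a b x k] that assms by (auto simp: R_def det3_cyclic)
  ultimately show ?thesis using R unfolding g_def R_def[symmetric] by (auto simp: prod_zero_iff)
qed

text \<open>The term without \<open>f\<close> vanishes by concurrency, so only the one without
  \<open>x\<close> is left. It contains \<open>(h f)\<^sup>2\<close>, a nonzero multiple of
  \<open>X Y\<close>, and its other two factors are nonzero at the point; the \<open>X Y\<close>
  coefficient decides.\<close>

lemma coeff_zero_inductive:
  assumes "a < 6" "b < 6" "a \<noteq> b" "f \<in> {..<6} - {a, b}" "dt a b f = 0"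
    and x: "x \<in> {..<6} - {a, b}" "x \<noteq> f"
    and zero: "\<And>j. j \<in> {..<6} - {a, b} \<Longrightarrow> j \<noteq> x \<Longrightarrow> j \<noteq> f \<Longrightarrow> c ({..<6} - {a, b} - {j}) = 0"
  shows "c ({..<6} - {a, b} - {x}) = 0"
proof -
  obtain m where m: "det3 (L a) (L b) m \<noteq> 0" using not_parallel assms by auto
  define R where "R = {..<6} - {a, b}"
  define p where "p j = det3 (L j) (L b) m * det3 (L j) m (L a)" for j
  define h where "h j = Jet (dt j a b) (det3 (L j) (L b) m) (det3 (L j) m (L a)) 0" for j
  define g where "g j = jc (c (R - {j})) * (\<Prod>k\<in>R - {j}. (h k)\<^sup>2)" for j
  have R: "finite R" "x \<in> R" "f \<in> R" using assms by (simp_all add: R_def)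
  have f: "dt f a b = 0" using assms by (simp add: det3_cyclic)
  have p: "p f \<noteq> 0"
    using concurrent_coordinates_nonzero[OF assms(1-4) f m] by (simp add: p_def)
  have hf: "(h f)\<^sup>2 = Jet 0 0 0 (2 * p f)"
    by (simp add: h_def f p_def jet_defs power2_eq_square)
  have "c (R - {j}) = 0" if "j \<in> R - {x}" for j
    using zero[of j] coeff_zero_concurrent[OF assms(1-5)] that by (auto simp: R_def)
  then have "(\<Sum>j\<in>R. g j) = (\<Sum>j\<in>{x}. g j)"
    by (intro sum.mono_neutral_right) (use R in \<open>auto simp: g_def jc_simps\<close>)
  moreover have "(\<Sum>j\<in>R. g j) = 0"
    using jet_relation[OF assms(1-3), of m] by (simp add: g_def R_def h_def)
  ultimately have "j11 (g x) = 0" by (simp add: zero_jet_def)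
  moreover have "(\<Prod>k\<in>R - {x}. (h k)\<^sup>2) = (h f)\<^sup>2 * (\<Prod>k\<in>R - {x} - {f}. (h k)\<^sup>2)"
    using R x(2) by (intro prod.remove) auto
  ultimately have "c (R - {x}) * (2 * p f * (\<Prod>k\<in>R - {x} - {f}. dt k a b ^ 2)) = 0"
    by (simp add: g_def hf times_jet_def jc_def j00_prod j00_power2) (simp add: h_def)
  moreover have "dt k a b \<noteq> 0" if "k \<in> R - {x} - {f}" for k
    using at_most_one_concurrent[of a b f k] that assms by (auto simp: R_def det3_cyclic)
  ultimately show ?thesis using R p unfolding R_def[symmetric] by (auto simp: prod_zero_iff)
qed

end

section \<open>Vanishing of all coefficients\<close>

context six_forms_relation
begin

lemma coeff_zero_clean_triple:
  assumes "distinct [a, b, x, p, q, r]" "{a, b, x, p, q, r} \<subseteq> {..<6}"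
    "dt a b x \<noteq> 0" "dt a b p \<noteq> 0" "dt a b q \<noteq> 0" "dt a b r \<noteq> 0"
  shows "c {p, q, r} = 0"
proof -
  have "{a, b, x, p, q, r} = {..<6}"
    by (rule card_subset_eq) (use assms(1,2) in auto)
  then have R: "{..<6} - {a, b} = {x, p, q, r}" "{..<6} - {a, b} - {x} = {p, q, r}"
    using assms(1) by auto
  show ?thesis
    using coeff_zero_clean[of a b x] assms unfolding R by auto
qed

text \<open>The cases concern the complementary lines \<open>a\<close>, \<open>b\<close>,
  \<open>e\<close>: they are concurrent, or some vertex of their triangle lies on no further line,
  or every vertex does.\<close>

lemma coeff_zero_all:
  assumes "{a, b, e, p, q, r} = {..<6}" "distinct [a, b, e, p, q, r]"
  shows "c {p, q, r} = 0"
proof -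
  have le: "a < 6" "b < 6" "e < 6" "p < 6" "q < 6" "r < 6" using assms(1) by auto
  have sym: "(dt j i k = 0) = (dt i j k = 0)" "(dt i k j = 0) = (dt i j k = 0)" for i j k
    by (metis det3_perms neg_equal_0_iff_equal)+
  have amo: False if "dt i j k = 0" "dt i j l = 0" "distinct [i, j, k, l]"
      "{i, j, k, l} \<subseteq> {..<6}" for i j k l
    using at_most_one_concurrent[of i j k l] that by auto
  consider (conc) "dt a b e = 0"
    | (clean) i j k where "{i, j, k} = {a, b, e}" "distinct [i, j, k]" "dt i j k \<noteq> 0"
        "dt i j p \<noteq> 0" "dt i j q \<noteq> 0" "dt i j r \<noteq> 0"
    \<comment> \<open>each vertex of the triangle \<open>l\<^sub>a l\<^sub>b l\<^sub>e\<close> lies on a further line\<close>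
    | (ceva) f d g where "{f, d, g} \<subseteq> {p, q, r}" "dt a b f = 0" "dt b e d = 0" "dt a e g = 0"
        "dt a b e \<noteq> 0"
  proof -
    show thesis
    proof (cases "dt a b e = 0")
      case False
      have nz: "dt b e a \<noteq> 0" "dt a e b \<noteq> 0" using False by (simp_all add: sym)
      have "{b, e, a} = {a, b, e}" "{a, e, b} = {a, b, e}" by auto
      moreover have "distinct [a, b, e]" "distinct [b, e, a]" "distinct [a, e, b]"
        using assms(2) by auto
      ultimately show thesis
        using clean[of a b e] clean[of b e a] clean[of a e b] ceva False nz
        by (metis insert_subset insertCI empty_subsetI)
    qed (fact conc)
  qed
  then show ?thesis
  proof cases
    case conc
    have "{..<6} - {a, b} - {e} = {p, q, r}" using assms by auto
    moreover have "e \<in> {..<6} - {a, b}" using assms by auto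
    ultimately show ?thesis
      using coeff_zero_concurrent[of a b e] conc le assms(2) by auto
  next
    case (clean i j k)
    show ?thesis
    proof (rule coeff_zero_clean_triple[of i j k])
      have "i \<in> {a, b, e}" "j \<in> {a, b, e}" "k \<in> {a, b, e}" unfolding clean(1)[symmetric] by simp_all
      then show "distinct [i, j, k, p, q, r]" using clean(2) assms(2) by auto
      show "{i, j, k, p, q, r} \<subseteq> {..<6}" using clean(1) assms(1) by auto
    qed (use clean in auto)
  next
    case (ceva f d g)
    have mem: "f \<in> {p, q, r}" "d \<in> {p, q, r}" "g \<in> {p, q, r}" using ceva(1) by auto
    have new: "x \<noteq> a" "x \<noteq> b" "x \<noteq> e" "x < 6" if "x \<in> {p, q, r}" for x
      using that assms(2) le by auto
    have abe: "a \<noteq> b" "a \<noteq> e" "b \<noteq> e" using assms(2) by auto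
    note new' = new[OF mem(1)] new[OF mem(2)] new[OF mem(3)]
    \<comment> \<open>A line through two vertices would share a point with three concurrent sides,
      or equivalently make four lines concurrent.\<close>
    have fd: "f \<noteq> d" using amo[of b f a e] ceva new' abe le by (auto simp: sym)
    have fg: "f \<noteq> g" using amo[of a f b e] ceva new' abe le by (auto simp: sym)
    have dg: "d \<noteq> g" using amo[of e d b a] ceva new' abe le by (auto simp: sym)
    have pqr: "{p, q, r} = {f, d, g}"
      by (rule card_subset_eq[symmetric]) (use ceva(1) fd fg dg assms(2) in auto)
    have R: "{..<6} - {a, b} = {e, f, d, g}"
      using assms pqr by auto
    \<comment> \<open>A third line through the point where \<open>a\<close> and \<open>d\<close>
      meet would join a known concurrent triple and make four lines concurrent, so this point is
      clean. The same holds for \<open>b\<close> and \<open>g\<close> below.\<close>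
    have d0: "c {e, f, g} = 0"
    proof (rule coeff_zero_clean_triple[of a d b])
      show "dt a d b \<noteq> 0" using amo[of b d a e] ceva new' abe le by (auto simp: sym)
      show "dt a d e \<noteq> 0" using amo[of e d a b] ceva new' abe le by (auto simp: sym)
      show "dt a d f \<noteq> 0" using amo[of a f d b] ceva new' abe le fd by (auto simp: sym)
      show "dt a d g \<noteq> 0" using amo[of a g d e] ceva new' abe le dg by (auto simp: sym)
    qed (use new' abe le fd fg dg in auto)
    have g0: "c {e, f, d} = 0"
    proof (rule coeff_zero_clean_triple[of b g a])
      show "dt b g a \<noteq> 0" using amo[of a g b e] ceva new' abe le by (auto simp: sym)
      show "dt b g e \<noteq> 0" using amo[of e g b a] ceva new' abe le by (auto simp: sym)
      show "dt b g f \<noteq> 0" using amo[of b f g a] ceva new' abe le fg by (auto simp: sym)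
      show "dt b g d \<noteq> 0" using amo[of b d g e] ceva new' abe le dg by (auto simp: sym)
    qed (use new' abe le fd fg dg in auto)
    have Rd: "{..<6} - {a, b} - {e} = {f, d, g}" "{..<6} - {a, b} - {d} = {e, f, g}"
      "{..<6} - {a, b} - {g} = {e, f, d}"
      unfolding R using new' fd fg dg by auto
    \<comment> \<open>Back at the vertex of \<open>a\<close> and \<open>b\<close>: the terms without
      \<open>d\<close> and without \<open>g\<close> are gone, so only \<open>e\<close> and
      \<open>f\<close> remain.\<close>
    have "c ({..<6} - {a, b} - {e}) = 0"
    proof (rule coeff_zero_inductive[of a b f])
      show "c ({..<6} - {a, b} - {j}) = 0" if "j \<in> {..<6} - {a, b}" "j \<noteq> e" "j \<noteq> f" for j
      proof -
        have "j = d \<or> j = g" using that by (simp add: R)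
        then show ?thesis by (elim disjE) (simp_all only: Rd d0 g0)
      qed
    qed (use new' abe le ceva R in auto)
    then show ?thesis by (simp add: Rd pqr)
  qed
qed

end

lemma triple_products_independent:
  fixes L :: "nat \<Rightarrow> nat \<Rightarrow> complex"
  assumes "lin_indep_fam {..<6} (\<lambda>i. (form (L i))\<^sup>2)"
  shows "lin_indep_fam (prod_fam_index 3 {..<6}) (prod_fam (\<lambda>i. (form (L i))\<^sup>2))"
  unfolding lin_indep_fam_def
proof (intro allI impI ballI)
  fix c and T :: "nat set"
  assume rel: "(\<Sum>T\<in>prod_fam_index 3 {..<6}. Const (c T) * prod_fam (\<lambda>i. (form (L i))\<^sup>2) T) = 0"
    and "T \<in> prod_fam_index 3 {..<6}"
  interpret six_forms_relation L c
    by unfold_locales (fact assms rel)+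
  have T: "T \<subseteq> {..<6}" "card T = 3" "finite T"
    using \<open>T \<in> _\<close> by (auto simp: prod_fam_index_def finite_subset)
  then have "card ({..<6} - T) = 3" by (simp add: card_Diff_subset)
  then obtain a b e where U: "{..<6} - T = {a, b, e}" "a \<noteq> b" "b \<noteq> e" "a \<noteq> e"
    by (auto simp: card_3_iff)
  obtain p q r where T': "T = {p, q, r}" "p \<noteq> q" "q \<noteq> r" "p \<noteq> r"
    using T(2) by (auto simp: card_3_iff)
  have "{a, b, e, p, q, r} = {a, b, e} \<union> {p, q, r}" by auto
  also have "\<dots> = ({..<6} - T) \<union> T" by (simp only: U(1)[symmetric] T'(1)[symmetric])
  also have "\<dots> = {..<6}" using T(1) by auto
  finally have "{a, b, e, p, q, r} = {..<6}" .
  moreover have "distinct [a, b, e, p, q, r]"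
  proof -
    have "{a, b, e} \<inter> {p, q, r} = {}" using U(1) T'(1) by auto
    then show ?thesis using U T' by auto
  qed
  ultimately show "c T = 0" unfolding T'(1) by (rule coeff_zero_all)
qed

section \<open>Enumeration of the twenty triples\<close>

text \<open>Pascal's recursion: a subset either avoids \<open>x\<close> or arises by inserting it.
  Iterating this lists all triples.\<close>

lemma sum_prod_fam_index_insert:
  assumes "finite A" "x \<notin> A"
  shows "sum g (prod_fam_index (Suc n) (insert x A)) =
    sum g (prod_fam_index (Suc n) A) + (\<Sum>K\<in>prod_fam_index n A. g (insert x K))"
proof -
  have fin: "finite (prod_fam_index k A)" for k
    by (rule finite_subset[of _ "Pow A"]) (use assms(1) in \<open>auto simp: prod_fam_index_def\<close>)
  have "prod_fam_index (Suc n) (insert x A) =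
      prod_fam_index (Suc n) A \<union> insert x ` prod_fam_index n A" (is "?l = ?r")
  proof (intro equalityI subsetI)
    fix K assume K: "K \<in> ?l"
    show "K \<in> ?r"
    proof (cases "x \<in> K")
      case True
      have "finite K" using K assms(1) by (auto simp: prod_fam_index_def intro: finite_subset)
      then have "K - {x} \<in> prod_fam_index n A" using K True by (auto simp: prod_fam_index_def)
      then have "insert x (K - {x}) \<in> ?r" by blast
      then show ?thesis using True by (simp add: insert_absorb)
    qed (use K in \<open>auto simp: prod_fam_index_def\<close>)
  next
    fix K assume "K \<in> ?r"
    then show "K \<in> ?l"
      using assms by (auto simp: prod_fam_index_def card_insert_if finite_subset)
  qed
  moreover have "prod_fam_index (Suc n) A \<inter> insert x ` prod_fam_index n A = {}"
    using assms(2) by (auto simp: prod_fam_index_def)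
  moreover have "inj_on (insert x) (prod_fam_index n A)"
    using assms(2) by (auto simp: inj_on_def prod_fam_index_def)
  ultimately show ?thesis
    using fin by (simp add: sum.union_disjoint sum.reindex)
qed

lemma prod_fam_index_0: "finite A \<Longrightarrow> prod_fam_index 0 A = {{}}"
  by (auto simp: prod_fam_index_def finite_subset)

lemma prod_fam_index_empty: "prod_fam_index (Suc n) {} = {}"
  by (auto simp: prod_fam_index_def)

lemma sum_triples:
  fixes g :: "nat set \<Rightarrow> 'a::comm_monoid_add"
  shows "sum g (prod_fam_index 3 {..<6}) =
    g {0,1,2} + g {0,1,3} + g {0,1,4} + g {0,1,5} + g {0,2,3} + g {0,2,4} + g {0,2,5}
    + g {0,3,4} + g {0,3,5} + g {0,4,5} + g {1,2,3} + g {1,2,4} + g {1,2,5} + g {1,3,4}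
    + g {1,3,5} + g {1,4,5} + g {2,3,4} + g {2,3,5} + g {2,4,5} + g {3,4,5}"
proof -
  have "{..<6::nat} = {0,1,2,3,4,5}" by auto
  then show ?thesis
    by (simp add: numeral_3_eq_3 sum_prod_fam_index_insert prod_fam_index_0 prod_fam_index_empty ac_simps)
qed

section \<open>Identities between products of squares\<close>

text \<open>
  Here \<open>x, y, z, f, g, h\<close> are six lines of which the first three are the coordinate lines. The
  coefficient of the product over a triple \<open>T\<close> with complement \<open>U\<close> is \<open>\<plusminus>[U]\<^sup>3 [T]\<close>, where \<open>[\<dots>]\<close> is the
  determinant of the three lines. It was found for six tangents \<open>z\<^sub>1 + t z\<^sub>2 + t\<^sup>2 z\<^sub>3\<close> of a conic, where
  determinants are Vandermonde. The factor \<open>e\<close> is the determinant of the six squares.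
\<close>

lemma six_lines_identity:
  fixes a0 a1 a2 b0 b1 b2 c0 c1 c2 x y z :: "'a::idom"
  defines "f \<equiv> a0*x + a1*y + a2*z" and "g \<equiv> b0*x + b1*y + b2*z" and "h \<equiv> c0*x + c1*y + c2*z"
  defines "d \<equiv> a0*(b1*c2-b2*c1) - a1*(b0*c2-b2*c0) + a2*(b0*c1-b1*c0)"
  defines "m0 \<equiv> b1*c2-b2*c1" and "m1 \<equiv> b0*c2-b2*c0" and "m2 \<equiv> b0*c1-b1*c0"
  defines "n0 \<equiv> a1*c2-a2*c1" and "n1 \<equiv> a0*c2-a2*c0" and "n2 \<equiv> a0*c1-a1*c0"
  defines "k0 \<equiv> a1*b2-a2*b1" and "k1 \<equiv> a0*b2-a2*b0" and "k2 \<equiv> a0*b1-a1*b0"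
  defines "e \<equiv> a0*a1*(b0*b2*c1*c2-b1*b2*c0*c2) - a0*a2*(b0*b1*c1*c2-b1*b2*c0*c1)
    + a1*a2*(b0*b1*c0*c2-b0*b2*c0*c1)"
  shows "(-(d^3))*(x\<^sup>2*(y\<^sup>2*z\<^sup>2)) + m2^3*a2*(x\<^sup>2*(y\<^sup>2*f\<^sup>2)) + (-(n2^3*b2))*(x\<^sup>2*(y\<^sup>2*g\<^sup>2))
    + k2^3*c2*(x\<^sup>2*(y\<^sup>2*h\<^sup>2)) + (-(m1^3*a1))*(x\<^sup>2*(z\<^sup>2*f\<^sup>2)) + n1^3*b1*(x\<^sup>2*(z\<^sup>2*g\<^sup>2))
    + (-(k1^3*c1))*(x\<^sup>2*(z\<^sup>2*h\<^sup>2)) + (-(c0^3*k0))*(x\<^sup>2*(f\<^sup>2*g\<^sup>2)) + b0^3*n0*(x\<^sup>2*(f\<^sup>2*h\<^sup>2))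
    + (-(a0^3*m0))*(x\<^sup>2*(g\<^sup>2*h\<^sup>2)) + m0^3*a0*(y\<^sup>2*(z\<^sup>2*f\<^sup>2)) + (-(n0^3*b0))*(y\<^sup>2*(z\<^sup>2*g\<^sup>2))
    + k0^3*c0*(y\<^sup>2*(z\<^sup>2*h\<^sup>2)) + c1^3*k1*(y\<^sup>2*(f\<^sup>2*g\<^sup>2)) + (-(b1^3*n1))*(y\<^sup>2*(f\<^sup>2*h\<^sup>2))
    + a1^3*m1*(y\<^sup>2*(g\<^sup>2*h\<^sup>2)) + (-(c2^3*k2))*(z\<^sup>2*(f\<^sup>2*g\<^sup>2)) + b2^3*n2*(z\<^sup>2*(f\<^sup>2*h\<^sup>2))
    + (-(a2^3*m2))*(z\<^sup>2*(g\<^sup>2*h\<^sup>2)) + d*(f\<^sup>2*(g\<^sup>2*h\<^sup>2)) = - 6*e*x*y*z*f*g*h"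
  unfolding assms by algebra

text \<open>The analogue for four points of a line, with coefficients \<open>\<plusminus>[U]\<^sup>3 [T]\<close> for complementary pairs.\<close>

lemma four_concurrent_identity:
  fixes x y al be ga de :: "'a::idom"
  defines "i \<equiv> al*x + be*y" and "j \<equiv> ga*x + de*y"
  defines "w \<equiv> al*de - be*ga"
  shows "w*(i\<^sup>2*j\<^sup>2) + ga^3*be*(i\<^sup>2*x\<^sup>2) + (-(de^3*al))*(i\<^sup>2*y\<^sup>2) + (-(al^3*de))*(j\<^sup>2*x\<^sup>2)
    + be^3*ga*(j\<^sup>2*y\<^sup>2) + w^3*(x\<^sup>2*y\<^sup>2) = 0"
  unfolding assms by algebra

section \<open>From independent triple products to independent squares\<close>

locale independent_triples =
  fixes L :: "nat \<Rightarrow> nat \<Rightarrow> complex"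
  assumes indep: "lin_indep_fam (prod_fam_index 3 {..<6}) (prod_fam (\<lambda>i. (form (L i))\<^sup>2))"
begin

lemma indepD:
  assumes "(\<Sum>T\<in>X. Const (c T) * (\<Prod>i\<in>T. (form (L i))\<^sup>2)) = 0"
    "X \<subseteq> prod_fam_index 3 {..<6}" "T \<in> X"
  shows "c T = 0"
proof -
  define c' where "c' T = (if T \<in> X then c T else 0)" for T
  have "(\<Sum>T\<in>prod_fam_index 3 {..<6}. Const (c' T) * prod_fam (\<lambda>i. (form (L i))\<^sup>2) T) =
      (\<Sum>T\<in>X. Const (c' T) * prod_fam (\<lambda>i. (form (L i))\<^sup>2) T)"
  proof (rule sum.mono_neutral_right)
    show "finite (prod_fam_index 3 {..<6::nat})"
      by (rule finite_subset[of _ "Pow {..<6}"]) (auto simp: prod_fam_index_def)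
  qed (use assms in \<open>auto simp: c'_def Const_simps\<close>)
  also have "\<dots> = 0" using assms(1) by (simp add: c'_def prod_fam_def)
  finally have "c' T = 0" using indep assms(2,3) unfolding lin_indep_fam_def by blast
  then show ?thesis using assms(3) by (simp add: c'_def)
qed

text \<open>A proportionality, squared and multiplied by two further squares, is a relation between
  two triple products.\<close>

lemma no_parallel:
  assumes "i < 6" "j < 6" "i \<noteq> j" "Const s * form (L i) = Const t * form (L j)"
  shows "s = 0 \<and> t = 0"
proof -
  have "card ({..<6} - {i, j}) = 4" using assms by (simp add: card_Diff_subset)
  then obtain S where "S \<subseteq> {..<6} - {i, j}" "card S = 2" "finite S"
    using obtain_subset_with_card_n[of 2 "{..<6} - {i, j}"] by auto
  then obtain p q where pq: "p \<noteq> q" "{p, q} \<subseteq> {..<6} - {i, j}"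
    by (auto simp: card_2_iff)
  define c where "c T = (if i \<in> T then s\<^sup>2 else - t\<^sup>2)" for T :: "nat set"
  let ?X = "{{i, p, q}, {j, p, q}}"
  have ne: "{i, p, q} \<noteq> {j, p, q}" using pq assms by auto
  have X: "?X \<subseteq> prod_fam_index 3 {..<6}" using pq assms by (auto simp: prod_fam_index_def)
  have "(\<Sum>T\<in>?X. Const (c T) * (\<Prod>i\<in>T. (form (L i))\<^sup>2)) =
      ((Const s * form (L i))\<^sup>2 - (Const t * form (L j))\<^sup>2) * ((form (L p))\<^sup>2 * (form (L q))\<^sup>2)"
    using ne pq assms(1-3)
    by (simp add: c_def Const_simps power_mult_distrib) (simp add: algebra_simps)
  also have "\<dots> = 0" by (simp add: assms(4))
  finally have "c {i, p, q} = 0" "c {j, p, q} = 0" using X by (auto intro: indepD)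
  then show ?thesis using pq assms(3) by (auto simp: c_def split: if_splits)
qed

text \<open>With \<open>l\<^sub>i\<close> and \<open>l\<^sub>j\<close> written in terms of
  \<open>l\<^sub>k\<close> and \<open>l\<^sub>l\<close>, \<open>four_concurrent_identity\<close>
  times \<open>l\<^sub>r\<^sup>2\<close> is a relation between six triple products.\<close>

lemma no_four_concurrent:
  assumes "distinct [i, j, k, l, r]" "{i, j, k, l, r} \<subseteq> {..<6}"
    "det3 (L i) (L k) (L l) = 0"
  shows "det3 (L j) (L k) (L l) \<noteq> 0"
proof
  assume j: "det3 (L j) (L k) (L l) = 0"
  have "\<exists>m. det3 m (L k) (L l) \<noteq> 0"
  proof (rule ccontr)
    assume "\<nexists>m. det3 m (L k) (L l) \<noteq> 0"
    then obtain s t where "s \<noteq> 0 \<or> t \<noteq> 0" "Const s * form (L k) = Const t * form (L l)"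
      using parallel_forms[of "L k" "L l"] by blast
    then show False using no_parallel[of k l s t] assms(1,2) by simp
  qed
  then obtain m where m: "det3 m (L k) (L l) \<noteq> 0" ..
  have comb: "form (L v) = Const (det3 (L v) (L l) m / det3 m (L k) (L l)) * form (L k)
      + Const (det3 (L v) m (L k) / det3 m (L k) (L l)) * form (L l)"
    if "det3 (L v) (L k) (L l) = 0" for v
  proof -
    let ?D = "det3 m (L k) (L l)"
    have "form (L v) = Const (1 / ?D) * (Const ?D * form (L v))"
      using m by (simp add: mult.assoc[symmetric] Const_simps(4)[symmetric] Const_simps(2))
    also have "\<dots> = Const (1 / ?D) * (Const (det3 (L v) (L l) m) * form (L k)
        + Const (det3 (L v) m (L k)) * form (L l))"
      using cramer_form[of m "L k" "L l" "L v"] that by (simp add: Const_simps(1))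
    finally show ?thesis
      by (simp add: distrib_left mult.assoc[symmetric] Const_simps(4)[symmetric])
  qed
  obtain al be where I: "form (L i) = Const al * form (L k) + Const be * form (L l)"
    using comb[OF assms(3)] by blast
  obtain ga de where J: "form (L j) = Const ga * form (L k) + Const de * form (L l)"
    using comb[OF j] by blast
  define w where "w = al * de - be * ga"
  define c where "c T = (if i \<in> T then if j \<in> T then w else if k \<in> T then ga^3 * be else - (de^3 * al)
     else if j \<in> T then if k \<in> T then - (al^3 * de) else be^3 * ga else w^3)" for T :: "nat set"
  let ?X = "{{i, j, r}, {i, k, r}, {i, l, r}, {j, k, r}, {j, l, r}, {k, l, r}}"
  have X: "?X \<subseteq> prod_fam_index 3 {..<6}"
    using assms(1,2) by (auto simp: prod_fam_index_def)
  have nq: "i \<noteq> j" "i \<noteq> k" "i \<noteq> l" "i \<noteq> r" "j \<noteq> k" "j \<noteq> l" "j \<noteq> r" "k \<noteq> l" "k \<noteq> r" "l \<noteq> r"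
    "j \<noteq> i" "k \<noteq> i" "l \<noteq> i" "r \<noteq> i" "k \<noteq> j" "l \<noteq> j" "r \<noteq> j" "l \<noteq> k" "r \<noteq> k" "r \<noteq> l"
    using assms(1) by auto
  have notin: "A \<notin> S" if "\<forall>B\<in>S. \<exists>x\<in>{i, j, k, l}. x \<in> A \<and> x \<notin> B" for A :: "nat set" and S
    using that by blast
  have ne: "{i, j, r} \<notin> {{i, k, r}, {i, l, r}, {j, k, r}, {j, l, r}, {k, l, r}}"
    "{i, k, r} \<notin> {{i, l, r}, {j, k, r}, {j, l, r}, {k, l, r}}"
    "{i, l, r} \<notin> {{j, k, r}, {j, l, r}, {k, l, r}}"
    "{j, k, r} \<notin> {{j, l, r}, {k, l, r}}" "{j, l, r} \<notin> {{k, l, r}}"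
    by (rule notin, simp add: nq)+
  let ?F = "\<lambda>i. form (L i)"
  let ?C = "\<lambda>T. Const (c T) * (\<Prod>i\<in>T. (?F i)\<^sup>2)"
  have "(\<Sum>T\<in>?X. ?C T) = ?C {i, j, r} + (?C {i, k, r} + (?C {i, l, r} + (?C {j, k, r} + (?C {j, l, r} + ?C {k, l, r}))))"
    using ne by (simp only: sum.insert finite.intros sum.empty empty_iff not_False_eq_True add_0_right)
  also have "\<dots> = (?F r)\<^sup>2 * (Const w*((?F i)\<^sup>2*(?F j)\<^sup>2) + Const (ga^3*be)*((?F i)\<^sup>2*(?F k)\<^sup>2)
    + Const (- (de^3*al))*((?F i)\<^sup>2*(?F l)\<^sup>2) + Const (-(al^3*de))*((?F j)\<^sup>2*(?F k)\<^sup>2)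
    + Const (be^3*ga)*((?F j)\<^sup>2*(?F l)\<^sup>2) + Const (w^3)*((?F k)\<^sup>2*(?F l)\<^sup>2))"
    by (simp add: c_def nq Const_simps) (simp add: algebra_simps)
  also have "\<dots> = 0"
    using four_concurrent_identity[of "Const al" "Const de" "Const be" "Const ga" "?F k" "?F l"]
    by (simp add: I J w_def Const_simps)
  finally have "c {i, j, r} = 0" using X by (auto intro: indepD)
  then have w: "al * de = be * ga" by (simp add: c_def w_def)
  \<comment> \<open>As \<open>w = 0\<close>, the forms \<open>l\<^sub>i\<close> and
    \<open>l\<^sub>j\<close> are proportional in two ways; excluding this makes \<open>al\<close>
    and \<open>be\<close> zero, hence \<open>l\<^sub>i = 0\<close>, again a forbidden
    proportionality.\<close>
  have "Const de * ?F i = Const be * ?F j" "Const ga * ?F i = Const al * ?F j"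
    using w unfolding I J by (simp_all add: distrib_left mult.assoc[symmetric] Const_simps(4)[symmetric] ac_simps)
  then have "al = 0" "be = 0" using no_parallel[of i j] assms(1,2) by auto
  then have "Const 1 * ?F i = Const 0 * ?F j" by (simp add: I Const_simps)
  then show False using no_parallel[of i j 1 0] assms(1,2) by auto
qed

end

text \<open>A relation between the squares forces \<open>?e = 0\<close>, so
  \<open>six_lines_identity\<close> becomes a relation between the triple products. Its coefficients
  must then vanish, which makes \<open>l\<^sub>3\<close> zero.\<close>

lemma squares_independent:
  fixes a :: "nat \<Rightarrow> nat \<Rightarrow> complex"
  defines "L \<equiv> \<lambda>i j. if i < 3 then if i = j then 1 else 0 else a (i - 3) j"
  assumes "lin_indep_fam (prod_fam_index 3 {..<6}) (prod_fam (\<lambda>i. (form (L i))\<^sup>2))"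
  shows "lin_indep_fam {..<6} (\<lambda>i. (form (L i))\<^sup>2)"
  unfolding lin_indep_fam_def
proof (intro allI impI ballI, rule ccontr)
  interpret independent_triples L
    by unfold_locales (fact assms(2))
  fix c i
  assume rel: "(\<Sum>i<6. Const (c i) * (form (L i))\<^sup>2) = 0" and i: "i \<in> {..<6}" "c i \<noteq> 0"
  let ?q = "\<lambda>i. (form (L i))\<^sup>2"
  let ?a0 = "a 0 0" and ?a1 = "a 0 1" and ?a2 = "a 0 2"
    and ?b0 = "a 1 0" and ?b1 = "a 1 1" and ?b2 = "a 1 2"
    and ?c0 = "a 2 0" and ?c1 = "a 2 1" and ?c2 = "a 2 2"
  let ?m0 = "?b1*?c2-?b2*?c1" and ?m1 = "?b0*?c2-?b2*?c0" and ?m2 = "?b0*?c1-?b1*?c0"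
    and ?n0 = "?a1*?c2-?a2*?c1" and ?n1 = "?a0*?c2-?a2*?c0" and ?n2 = "?a0*?c1-?a1*?c0"
    and ?k0 = "?a1*?b2-?a2*?b1" and ?k1 = "?a0*?b2-?a2*?b0" and ?k2 = "?a0*?b1-?a1*?b0"
  let ?d = "?a0*(?b1*?c2-?b2*?c1) - ?a1*(?b0*?c2-?b2*?c0) + ?a2*(?b0*?c1-?b1*?c0)"
  let ?e = "?a0*?a1*(?b0*?b2*?c1*?c2-?b1*?b2*?c0*?c2) - ?a0*?a2*(?b0*?b1*?c1*?c2-?b1*?b2*?c0*?c1)
    + ?a1*?a2*(?b0*?b1*?c0*?c2-?b0*?b2*?c0*?c1)"
  have L: "L 0 = (\<lambda>j. if j = 0 then 1 else 0)" "L 1 = (\<lambda>j. if j = 1 then 1 else 0)"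
    "L (Suc 0) = (\<lambda>j. if j = 1 then 1 else 0)" "L 2 = (\<lambda>j. if j = 2 then 1 else 0)" "L 3 = a 0" "L 4 = a 1" "L 5 = a 2"
    by (auto simp: L_def fun_eq_iff)
  have lessThan_6: "{..<6} = {0, 1, 2, 3, 4, 5 :: nat}" by auto

  have eval: "c 0 * (x 0)\<^sup>2 + c 1 * (x 1)\<^sup>2 + c 2 * (x 2)\<^sup>2
      + c 3 * (?a0 * x 0 + ?a1 * x 1 + ?a2 * x 2)\<^sup>2 + c 4 * (?b0 * x 0 + ?b1 * x 1 + ?b2 * x 2)\<^sup>2
      + c 5 * (?c0 * x 0 + ?c1 * x 1 + ?c2 * x 2)\<^sup>2 = 0" for x :: "nat \<Rightarrow> complex"
  proof -
    have "j00 (psubst (\<lambda>i. Jet (x i) 0 0 0) (\<Sum>i<6. Const (c i) * ?q i)) = 0"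
      by (simp add: rel zero_jet_def)
    then have "(\<Sum>i<6. c i * (\<Sum>j<3. L i j * x j)\<^sup>2) = 0"
      by (simp add: psubst_sum jet_sel_sum psubst_mult psubst_power psubst_form times_jet_def
          j00_power2 jc_def)
    moreover have "(\<Sum>j<3. g j) = g 0 + g 1 + g 2" for g :: "nat \<Rightarrow> complex"
      by (simp add: lessThan_3)
    ultimately show ?thesis by (simp only: lessThan_6) (simp add: L add.assoc)
  qed
  have diag: "c 0 + c 3 * ?a0\<^sup>2 + c 4 * ?b0\<^sup>2 + c 5 * ?c0\<^sup>2 = 0"
    "c 1 + c 3 * ?a1\<^sup>2 + c 4 * ?b1\<^sup>2 + c 5 * ?c1\<^sup>2 = 0"
    "c 2 + c 3 * ?a2\<^sup>2 + c 4 * ?b2\<^sup>2 + c 5 * ?c2\<^sup>2 = 0"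
    using eval[of "\<lambda>j. if j = 0 then 1 else 0"] eval[of "\<lambda>j. if j = 1 then 1 else 0"]
      eval[of "\<lambda>j. if j = 2 then 1 else 0"] by simp_all
  \<comment> \<open>Mixed coefficients come from evaluation at points with two coordinates 1 and one
    0, after subtracting the diagonal ones.\<close>
  have "c 3 * (?a0 * ?a1) + c 4 * (?b0 * ?b1) + c 5 * (?c0 * ?c1) = 0"
    using eval[of "\<lambda>j. if j = 2 then 0 else 1"] diag(1,2) by simp algebra
  moreover have "c 3 * (?a0 * ?a2) + c 4 * (?b0 * ?b2) + c 5 * (?c0 * ?c2) = 0"
    using eval[of "\<lambda>j. if j = 1 then 0 else 1"] diag(1,3) by simp algebra
  moreover have "c 3 * (?a1 * ?a2) + c 4 * (?b1 * ?b2) + c 5 * (?c1 * ?c2) = 0"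
    using eval[of "\<lambda>j. if j = 0 then 0 else 1"] diag(2,3) by simp algebra
  \<comment> \<open>\<open>?e\<close> is the determinant of the preceding homogeneous system in
    \<open>c 3\<close>, \<open>c 4\<close>, \<open>c 5\<close>.\<close>
  ultimately have "c 3 * ?e = 0 \<and> c 4 * ?e = 0 \<and> c 5 * ?e = 0" by algebra
  moreover have "c 3 \<noteq> 0 \<or> c 4 \<noteq> 0 \<or> c 5 \<noteq> 0"
    using i diag by (auto simp: lessThan_6)
  ultimately have e: "?e = 0" by (metis mult_eq_0_iff)

  let ?x = "form (L 0)" and ?y = "form (L 1)" and ?z = "form (L 2)"
    and ?f = "form (L 3)" and ?g = "form (L 4)" and ?h = "form (L 5)"
  have form_L: "?f = Const ?a0 * ?x + Const ?a1 * ?y + Const ?a2 * ?z"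
    "?g = Const ?b0 * ?x + Const ?b1 * ?y + Const ?b2 * ?z"
    "?h = Const ?c0 * ?x + Const ?c1 * ?y + Const ?c2 * ?z"
    by (simp_all add: form_def L lessThan_3 Const_simps)
  define tr where "tr xs = det3 (L (xs ! 0)) (L (xs ! 1)) (L (xs ! 2))" for xs
  \<comment> \<open>The coefficients of \<open>six_lines_identity\<close> in uniform shape.
    Filtering \<open>[0..<6]\<close> lists \<open>T\<close> and its complement in increasing order,
    which fixes the signs of the determinants.\<close>
  define cf where "cf T = (- 1) ^ (\<Sum>T) * tr (filter (\<lambda>i. i \<notin> T) [0..<6]) ^ 3
    * tr (filter (\<lambda>i. i \<in> T) [0..<6])" for T
  have upt: "[0..<6] = [0, 1, 2, 3, 4, 5 :: nat]" by (simp add: upt_rec)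
  have vals: "cf {0, 1, 2} = -(?d^3)" "cf {0, 1, 3} = ?m2^3*?a2"
    "cf {0, 1, 4} = -(?n2^3*?b2)" "cf {0, 1, 5} = ?k2^3*?c2"
    "cf {0, 2, 3} = -(?m1^3*?a1)" "cf {0, 2, 4} = ?n1^3*?b1"
    "cf {0, 2, 5} = -(?k1^3*?c1)" "cf {0, 3, 4} = -(?c0^3*?k0)"
    "cf {0, 3, 5} = ?b0^3*?n0" "cf {0, 4, 5} = -(?a0^3*?m0)"
    "cf {1, 2, 3} = ?m0^3*?a0" "cf {1, 2, 4} = -(?n0^3*?b0)"
    "cf {1, 2, 5} = ?k0^3*?c0" "cf {1, 3, 4} = ?c1^3*?k1"
    "cf {1, 3, 5} = -(?b1^3*?n1)" "cf {1, 4, 5} = ?a1^3*?m1"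
    "cf {2, 3, 4} = -(?c2^3*?k2)" "cf {2, 3, 5} = ?b2^3*?n2"
    "cf {2, 4, 5} = -(?a2^3*?m2)" "cf {3, 4, 5} = ?d"
    unfolding cf_def upt by (simp_all add: tr_def det3_def L power3_eq_cube algebra_simps)
  have prods: "prod_fam ?q {0, 1, 2} = ?x\<^sup>2*(?y\<^sup>2*?z\<^sup>2)" "prod_fam ?q {0, 1, 3} = ?x\<^sup>2*(?y\<^sup>2*?f\<^sup>2)"
    "prod_fam ?q {0, 1, 4} = ?x\<^sup>2*(?y\<^sup>2*?g\<^sup>2)" "prod_fam ?q {0, 1, 5} = ?x\<^sup>2*(?y\<^sup>2*?h\<^sup>2)"
    "prod_fam ?q {0, 2, 3} = ?x\<^sup>2*(?z\<^sup>2*?f\<^sup>2)" "prod_fam ?q {0, 2, 4} = ?x\<^sup>2*(?z\<^sup>2*?g\<^sup>2)"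
    "prod_fam ?q {0, 2, 5} = ?x\<^sup>2*(?z\<^sup>2*?h\<^sup>2)" "prod_fam ?q {0, 3, 4} = ?x\<^sup>2*(?f\<^sup>2*?g\<^sup>2)"
    "prod_fam ?q {0, 3, 5} = ?x\<^sup>2*(?f\<^sup>2*?h\<^sup>2)" "prod_fam ?q {0, 4, 5} = ?x\<^sup>2*(?g\<^sup>2*?h\<^sup>2)"
    "prod_fam ?q {1, 2, 3} = ?y\<^sup>2*(?z\<^sup>2*?f\<^sup>2)" "prod_fam ?q {1, 2, 4} = ?y\<^sup>2*(?z\<^sup>2*?g\<^sup>2)"
    "prod_fam ?q {1, 2, 5} = ?y\<^sup>2*(?z\<^sup>2*?h\<^sup>2)" "prod_fam ?q {1, 3, 4} = ?y\<^sup>2*(?f\<^sup>2*?g\<^sup>2)"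
    "prod_fam ?q {1, 3, 5} = ?y\<^sup>2*(?f\<^sup>2*?h\<^sup>2)" "prod_fam ?q {1, 4, 5} = ?y\<^sup>2*(?g\<^sup>2*?h\<^sup>2)"
    "prod_fam ?q {2, 3, 4} = ?z\<^sup>2*(?f\<^sup>2*?g\<^sup>2)" "prod_fam ?q {2, 3, 5} = ?z\<^sup>2*(?f\<^sup>2*?h\<^sup>2)"
    "prod_fam ?q {2, 4, 5} = ?z\<^sup>2*(?g\<^sup>2*?h\<^sup>2)" "prod_fam ?q {3, 4, 5} = ?f\<^sup>2*(?g\<^sup>2*?h\<^sup>2)"
    by (simp_all add: prod_fam_def)
  have "(\<Sum>T\<in>prod_fam_index 3 {..<6}. Const (cf T) * prod_fam ?q T)
      = - 6 * Const ?e * ?x * ?y * ?z * ?f * ?g * ?h"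
    unfolding sum_triples vals prods form_L Const_simps by (rule six_lines_identity)
  then have "(\<Sum>T\<in>prod_fam_index 3 {..<6}. Const (cf T) * prod_fam ?q T) = 0"
    unfolding e by (simp add: Const_simps)
  then have cf: "cf T = 0" if "T \<in> prod_fam_index 3 {..<6}" for T
    using assms(2) that unfolding lin_indep_fam_def by blast
  have "cf {0, 1, 2} = 0" "cf {0, 1, 3} = 0" "cf {0, 2, 3} = 0" "cf {1, 2, 3} = 0"
    by (rule cf, simp add: prod_fam_index_def)+
  then have d: "?d = 0" and m: "?m2 = 0 \<or> ?a2 = 0" "?m1 = 0 \<or> ?a1 = 0" "?m0 = 0 \<or> ?a0 = 0"
    by (simp_all only: vals neg_equal_0_iff_equal mult_eq_0_iff power_eq_0_iff) auto
  have d': "det3 (L 3) (L 4) (L 5) = 0" using d by (simp add: det3_def L)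
  \<comment> \<open>The index \<open>j\<close> supplies the fifth line required by
    \<open>no_four_concurrent\<close>. Up to sign, the determinants for \<open>i\<close> = 0, 1, 2
    are \<open>?m0\<close>, \<open>?m1\<close>, \<open>?m2\<close>.\<close>
  have no: "det3 (L i) (L 4) (L 5) \<noteq> 0" if "i \<noteq> j" "{i, j} \<subseteq> {0, 1, 2}" for i j
    using no_four_concurrent[of 3 i 4 5 j] that d' by auto
  have "?m0 \<noteq> 0" "?m1 \<noteq> 0" "?m2 \<noteq> 0"
    using no[of 0 1] no[of 1 0] no[of 2 0] by (simp_all add: det3_def L)
  then have "Const 1 * form (L 3) = Const 0 * form (L 4)"
    using m by (simp add: form_L Const_simps)
  then show False using no_parallel[of 3 4 1 0] by simp
qed

theorem theorem1p2:
  fixes a :: "nat \<Rightarrow> nat \<Rightarrow> complex"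
  defines "f \<equiv> (\<lambda>i. \<Sum>j<3. Const (a i j) * Var j)"
  defines "S1 \<equiv> (\<lambda>i::nat. if i < 3 then (Var i)^2 else (f (i - 3))^2)"
  shows "lin_indep_fam (prod_fam_index 3 {..<6}) (prod_fam S1)
         \<longleftrightarrow> lin_indep_fam {..<6} S1"
proof -
  \<comment> \<open>Unit vectors in the first three places make the variables linear forms like the
    \<open>f i\<close>.\<close>
  define L where "L = (\<lambda>i j. if i < 3 then if i = j then 1 else 0 else a (i - 3) j)"
  have "form (L i) = Var i" if "i < 3" for i
  proof -
    have "form (L i) = (\<Sum>j<3. if j = i then Var i else 0)"
      unfolding form_def by (rule sum.cong) (use that in \<open>auto simp: L_def Const_simps\<close>)
    then show ?thesis using that by simp
  qed
  moreover have "form (L i) = f (i - 3)" if "\<not> i < 3" for i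
    using that by (simp add: form_def L_def f_def)
  ultimately have "S1 = (\<lambda>i. (form (L i))\<^sup>2)" by (auto simp: S1_def)
  then show ?thesis
    using squares_independent[of a] triple_products_independent[of L] by (auto simp: L_def)
qed

end
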